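(* Let $X$ and $Y$ be spectra, let $\mathcal{F}_X$ and $\mathcal{F}_Y$ be families of subsets of $X$ and of $Y$ respectively (the admissible approval sets on each spectrum), and let $1\le k\le m$ be integers. Let $S=(X\times Y,V,\mathcal{A}^{X\times Y})$ be a $(k,m)$-agreeable product society with approval sets $A^X_v\times A^Y_v$, where $A^X_v\in\mathcal{F}_X$ and $A^Y_v\in\mathcal{F}_Y$ for all $v\in V$. Let $\alpha>0$ be a lower bound on the agreement proportion imposed by $(k,m)$-agreeability on $X$, that is, $\frac{a(T)}{|T|}\ge\alpha$ for every $(k,m)$-agreeable society $T$ with spectrum $X$ whose approval sets all belong to $\mathcal{F}_X$. Let $\beta>0$ be the analogous lower bound on $Y$, that is, $\frac{a(T)}{|T|}\ge\beta$ for every $(k,m)$-agreeable society $T$ with spectrum $Y$ whose approval sets all belong to $\mathcal{F}_Y$. If $|S|\ge\frac{m}{\min(\alpha,\beta)}$, then $$\frac{a(S)}{|S|}\ge\alpha\beta.$$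
   Context: A society is a triple $(X,V,\mathcal{A})$ consisting of a set $X$ (the spectrum, whose elements are called platforms), a finite set $V$ of voters, and a collection $\mathcal{A}=\{A_v\}_{v\in V}$ indexed by the voters, where $A_v\subseteq X$ is the approval set of voter $v$ (different voters may have equal approval sets). The size $|S|$ of a society $S$ is its number of voters. The agreement number $a(S)$ is the greatest number of voters that approve a single platform, i.e. $a(S)=\max_{p\in X}|\{v\in V: p\in A_v\}|$. The agreement proportion is $a(S)/|S|$. For integers $1\le k\le m\le|S|$, the society is $(k,m)$-agreeable if among every $m$ voters there are $k$ voters whose approval sets have a common platform; being $(k,m)$-agreeable includes $m\le |S|$. Given societies $(X,V,\{A^X_v\})$ and $(Y,V,\{A^Y_v\})$ with the same voters $V$, their product society is $(X\times Y,V,\mathcal{A}^{X\times Y})$, where $\mathcal{A}^{X\times Y}=\{A^X_v\times A^Y_v\mid v\in V\}$. *)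

theory Defs
  imports Complex_Main
begin

record ('v, 'p) society =
  spectrum :: "'p set"
  voters :: "'v set"
  approval :: "'v \<Rightarrow> 'p set"

text \<open>
  The function \<open>approval S\<close> is total; its values outside \<open>voters S\<close> carry no meaning, and no
  notion below depends on them.
\<close>

definition wf_society :: "('v, 'p) society \<Rightarrow> bool" where
  "wf_society S \<longleftrightarrow> finite (voters S) \<and> (\<forall>v\<in>voters S. approval S v \<subseteq> spectrum S)"

definition society_size :: "('v, 'p) society \<Rightarrow> nat" where
  "society_size S = card (voters S)"

text \<open>
  The set of which the maximum is taken is finite even for an infinite spectrum, since the voters
  are finite. It is empty, and the value unspecified, only for an empty spectrum; an agreeable
  society (in the sense below) always has a platform.
\<close>

definition agreement_number :: "('v, 'p) society \<Rightarrow> nat" where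
  "agreement_number S = Max ((\<lambda>p. card {v \<in> voters S. p \<in> approval S v}) ` spectrum S)"

definition agreement_proportion :: "('v, 'p) society \<Rightarrow> real" where
  "agreement_proportion S = real (agreement_number S) / real (society_size S)"

definition agreeable :: "nat \<Rightarrow> nat \<Rightarrow> ('v, 'p) society \<Rightarrow> bool" where
  "agreeable k m S \<longleftrightarrow>
     1 \<le> k \<and> k \<le> m \<and> m \<le> society_size S \<and>
     (\<forall>M. M \<subseteq> voters S \<and> card M = m \<longrightarrow>
        (\<exists>K. K \<subseteq> M \<and> card K = k \<and> (\<exists>p\<in>spectrum S. \<forall>v\<in>K. p \<in> approval S v)))"

text \<open>Meaningful only for two societies with the same voters.\<close>

definition prod_society :: "('v, 'p) society \<Rightarrow> ('v, 'q) society \<Rightarrow> ('v, 'p \<times> 'q) society" where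
  "prod_society S T =
     \<lparr>spectrum = spectrum S \<times> spectrum T,
      voters = voters S,
      approval = (\<lambda>v. approval S v \<times> approval T v)\<rparr>"

text \<open>
  A quantifier over all societies cannot range over all types of voters. As voter sets are finite
  and nothing depends on the nature of the voters, every society is a renaming of one whose voters
  are natural numbers, so quantifying over the latter loses no generality.
\<close>

definition agreement_lower_bound ::
  "nat \<Rightarrow> nat \<Rightarrow> 'p set \<Rightarrow> 'p set set \<Rightarrow> real \<Rightarrow> bool" where
  "agreement_lower_bound k m X F \<alpha> \<longleftrightarrow>
     (\<forall>T :: (nat, 'p) society.
        wf_society T \<and> spectrum T = X \<and> (\<forall>v\<in>voters T. approval T v \<in> F) \<and> agreeable k m T
        \<longrightarrow> agreement_proportion T \<ge> \<alpha>)"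

end

theory Submission
  imports Defs
begin

text \<open>
  The bounds on the two factors are applied one after the other. Agreeability of the product society
  passes to both factors, because a platform \<open>(p, q)\<close> shared by \<open>k\<close> voters gives them the shared
  platforms \<open>p\<close> and \<open>q\<close>. Hence some \<open>p\<close> in \<open>X\<close> is approved by a set \<open>W\<close> of at least \<open>\<alpha> |S|\<close>
  voters. Agreeability is a condition on sets of \<open>m\<close> voters, so it is inherited by every set of at
  least \<open>m\<close> voters. The assumed size of \<open>S\<close> makes \<open>W\<close> that large, and the bound for \<open>Y\<close> applies to
  the voters in \<open>W\<close> alone: some \<open>q\<close> in \<open>Y\<close> is approved by at least \<open>\<beta> |W|\<close> of them. All of these
  approve \<open>(p, q)\<close>, and they number at least \<open>\<alpha> \<beta> |S|\<close>.

  The lower bounds speak of societies whose voters are natural numbers, so they are brought to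
  arbitrary voters by numbering the voters (\<open>popular_platform\<close>).
\<close>

lemma finite_approval_counts:
  assumes "finite (voters S)"
  shows "finite ((\<lambda>p. card {v \<in> voters S. p \<in> approval S v}) ` spectrum S)"
proof (rule finite_subset)
  show "(\<lambda>p. card {v \<in> voters S. p \<in> approval S v}) ` spectrum S \<subseteq> {..card (voters S)}"
    using assms by (auto intro: card_mono)
qed simp

lemma card_approvers_le_agreement_number:
  assumes "finite (voters S)" "p \<in> spectrum S"
  shows "card {v \<in> voters S. p \<in> approval S v} \<le> agreement_number S"
  unfolding agreement_number_def
  using assms by (intro Max_ge finite_approval_counts) auto

lemma agreement_number_attained:
  assumes "finite (voters S)" "spectrum S \<noteq> {}"
  obtains p where "p \<in> spectrum S" "card {v \<in> voters S. p \<in> approval S v} = agreement_number S"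
proof -
  have "agreement_number S \<in> (\<lambda>p. card {v \<in> voters S. p \<in> approval S v}) ` spectrum S"
    unfolding agreement_number_def
    using assms by (intro Max_in finite_approval_counts) auto
  then show thesis
    using that by force
qed

lemma agreeable_imp_spectrum_nonempty:
  assumes "agreeable k m S"
  shows "spectrum S \<noteq> {}"
proof -
  have "m \<le> card (voters S)"
    using assms by (simp add: agreeable_def society_size_def)
  then obtain M where "M \<subseteq> voters S" "card M = m"
    by (rule obtain_subset_with_card_n)
  then show ?thesis
    using assms unfolding agreeable_def by (metis empty_iff)
qed

lemma agreeable_restrict_voters:
  assumes "agreeable k m S" "W \<subseteq> voters S" "m \<le> card W"
  shows "agreeable k m (S\<lparr>voters := W\<rparr>)"
proof -
  have "\<forall>M. M \<subseteq> W \<and> card M = m \<longrightarrow>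
    (\<exists>K. K \<subseteq> M \<and> card K = k \<and> (\<exists>p\<in>spectrum S. \<forall>v\<in>K. p \<in> approval S v))"
  proof (intro allI impI, elim conjE)
    fix M assume "M \<subseteq> W" "card M = m"
    then have "M \<subseteq> voters S \<and> card M = m"
      using assms(2) by simp
    then show "\<exists>K. K \<subseteq> M \<and> card K = k \<and> (\<exists>p\<in>spectrum S. \<forall>v\<in>K. p \<in> approval S v)"
      using assms(1) unfolding agreeable_def by metis
  qed
  moreover have "1 \<le> k" "k \<le> m"
    using assms(1) by (simp_all add: agreeable_def)
  ultimately show ?thesis
    using assms(3) by (simp add: agreeable_def society_size_def)
qed

text \<open>
  Voters who agree on \<open>p\<close> still agree on \<open>f p\<close>, since \<open>f\<close> loses no approver. The intended \<open>f\<close> are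
  the two coordinate projections of a product society.
\<close>

lemma agreeable_replace_platforms:
  assumes "agreeable k m S" "voters T = voters S"
    and f: "\<And>p. p \<in> spectrum S \<Longrightarrow> f p \<in> spectrum T"
    and app: "\<And>p v. p \<in> approval S v \<Longrightarrow> f p \<in> approval T v"
  shows "agreeable k m T"
proof -
  have "\<exists>K. K \<subseteq> M \<and> card K = k \<and> (\<exists>q\<in>spectrum T. \<forall>v\<in>K. q \<in> approval T v)"
    if M: "M \<subseteq> voters S" "card M = m" for M
  proof -
    obtain K p where "K \<subseteq> M" "card K = k" "p \<in> spectrum S" "\<forall>v\<in>K. p \<in> approval S v"
      using assms(1) M unfolding agreeable_def by metis
    then show ?thesis
      using f app by (intro exI[of _ K] conjI bexI[of _ "f p"]) auto
  qed
  then show ?thesis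
    using assms(1,2) by (simp add: agreeable_def society_size_def)
qed

lemma agreeable_prod_society_left:
  assumes "agreeable k m (prod_society S T)"
  shows "agreeable k m S"
  by (rule agreeable_replace_platforms[OF assms, where f = fst]) (auto simp: prod_society_def)

lemma agreeable_prod_society_right:
  assumes "agreeable k m (prod_society S T)" "voters S = voters T"
  shows "agreeable k m T"
  using assms(2)
  by (intro agreeable_replace_platforms[OF assms(1), where f = snd]) (auto simp: prod_society_def)

text \<open>
  Agreeability depends only on how the approval sets overlap, not on the identity of the voters:
  a group of new voters is sent by \<open>g\<close> to an equally large group of old ones, and the agreeing
  subgroup found there is pulled back along \<open>g\<close>.
\<close>

lemma agreeable_rename_voters:
  assumes "agreeable k m S" and bij: "bij_betw g N (voters S)"
  shows "agreeable k m \<lparr>spectrum = spectrum S, voters = N, approval = approval S \<circ> g\<rparr>"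
proof -
  have inj: "inj_on g N" and img: "g ` N = voters S"
    using bij by (auto simp: bij_betw_def)
  have "\<exists>K. K \<subseteq> M \<and> card K = k \<and> (\<exists>p\<in>spectrum S. \<forall>n\<in>K. p \<in> approval S (g n))"
    if M: "M \<subseteq> N" "card M = m" for M
  proof -
    have injM: "inj_on g M"
      using inj M(1) by (rule inj_on_subset)
    have "g ` M \<subseteq> voters S" "card (g ` M) = m"
      using M img injM by (auto simp: card_image)
    then obtain K p where K: "K \<subseteq> g ` M" "card K = k"
      and p: "p \<in> spectrum S" "\<forall>v\<in>K. p \<in> approval S v"
      using assms(1) unfolding agreeable_def by metis
    obtain L where L: "L \<subseteq> M" "K = g ` L"
      using K(1) by (auto simp: subset_image_iff)
    have "card L = k"
      using K(2) L injM by (metis card_image inj_on_subset)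
    then show ?thesis
      using L p by auto
  qed
  moreover have "card N = card (voters S)"
    using bij by (rule bij_betw_same_card)
  ultimately show ?thesis
    using assms(1) by (simp add: agreeable_def society_size_def)
qed

text \<open>
  The bound in its usable form: for voters of any type, and as a platform with many approvers
  instead of a quotient. Numbering the voters changes neither the approval counts nor agreeability.
\<close>

lemma popular_platform:
  fixes S :: "('v, 'p) society"
  assumes bound: "agreement_lower_bound k m (spectrum S) F c"
    and wf: "wf_society S"
    and adm: "\<forall>v\<in>voters S. approval S v \<in> F"
    and agr: "agreeable k m S"
  obtains p where "p \<in> spectrum S"
    "c * real (card (voters S)) \<le> real (card {v \<in> voters S. p \<in> approval S v})"
proof -
  have fin: "finite (voters S)"
    using wf by (simp add: wf_society_def)
  obtain g :: "nat \<Rightarrow> 'v" where bij: "bij_betw g {0..<card (voters S)} (voters S)"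
    using fin ex_bij_betw_nat_finite by blast
  define T where "T = \<lparr>spectrum = spectrum S, voters = {0..<card (voters S)},
    approval = approval S \<circ> g\<rparr>"
  have agrT: "agreeable k m T"
    unfolding T_def using agr bij by (rule agreeable_rename_voters)
  have g_voter: "g n \<in> voters S" if "n < card (voters S)" for n
    using bij that by (auto simp: bij_betw_def)
  have "wf_society T" "\<forall>n\<in>voters T. approval T n \<in> F"
    using wf adm g_voter by (auto simp: T_def wf_society_def)
  then have "c \<le> agreement_proportion T"
    using bound agrT unfolding agreement_lower_bound_def by (simp add: T_def)
  moreover have "0 < card (voters S)"
    using agr by (auto simp: agreeable_def society_size_def)
  ultimately have le: "c * real (card (voters S)) \<le> real (agreement_number T)"
    by (simp add: agreement_proportion_def society_size_def T_def pos_le_divide_eq)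
  have "finite (voters T)"
    by (simp add: T_def)
  then obtain p where p: "p \<in> spectrum T"
    "card {n \<in> voters T. p \<in> approval T n} = agreement_number T"
    using agreeable_imp_spectrum_nonempty[OF agrT] by (rule agreement_number_attained)
  have "g ` {n \<in> voters T. p \<in> approval T n} = {v \<in> voters S. p \<in> approval S v}"
    using bij by (force simp: T_def bij_betw_def)
  moreover have "inj_on g {n \<in> voters T. p \<in> approval T n}"
    using bij by (auto simp: T_def bij_betw_def inj_on_def)
  ultimately have "card {v \<in> voters S. p \<in> approval S v} = agreement_number T"
    using p(2) card_image by metis
  with le p(1) show thesis
    by (intro that[of p]) (auto simp: T_def)
qed

theorem theorem6:
  fixes X :: "'p set" and Y :: "'q set"
    and FX :: "'p set set" and FY :: "'q set set"
    and SX :: "('v, 'p) society" and SY :: "('v, 'q) society"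
    and S :: "('v, 'p \<times> 'q) society"
    and k m :: nat and \<alpha> \<beta> :: real
  assumes "FX \<subseteq> Pow X" and "FY \<subseteq> Pow Y"
    and "1 \<le> k" and "k \<le> m"
    and "wf_society SX" and "spectrum SX = X"
    and "wf_society SY" and "spectrum SY = Y"
    and "voters SX = voters SY"
    and "S = prod_society SX SY"
    and "agreeable k m S"
    and "\<forall>v\<in>voters S. approval SX v \<in> FX"
    and "\<forall>v\<in>voters S. approval SY v \<in> FY"
    and "\<alpha> > 0" and "agreement_lower_bound k m X FX \<alpha>"
    and "\<beta> > 0" and "agreement_lower_bound k m Y FY \<beta>"
    and "real (society_size S) \<ge> real m / min \<alpha> \<beta>"
  shows "agreement_proportion S \<ge> \<alpha> * \<beta>"
proof -
  define V where "V = voters SX"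
  have V: "voters S = V" "voters SX = V" "voters SY = V"
    using assms(9,10) by (simp_all add: V_def prod_society_def)
  have finV: "finite V"
    using assms(5) V by (simp add: wf_society_def)
  have agr: "agreeable k m (prod_society SX SY)"
    using assms(10,11) by simp
  have posV: "0 < card V"
    using assms(11) V by (auto simp: agreeable_def society_size_def)

  have "agreeable k m SX"
    using agr by (rule agreeable_prod_society_left)
  then obtain p where p: "p \<in> X"
    "\<alpha> * real (card V) \<le> real (card {v \<in> V. p \<in> approval SX v})"
    using popular_platform[of k m SX FX \<alpha>] assms(5,6,12,15) V by auto
  define W where "W = {v \<in> V. p \<in> approval SX v}"

  have "real m \<le> real (card V) * min \<alpha> \<beta>"
    using assms(14,16,18) V by (simp add: society_size_def pos_divide_le_eq)
  also have "\<dots> \<le> real (card V) * \<alpha>"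
    by (intro mult_left_mono) auto
  also have "\<dots> \<le> real (card W)"
    using p(2) by (simp add: W_def mult.commute)
  finally have "m \<le> card W"
    by simp
  moreover have "agreeable k m SY"
    using agr assms(9) by (rule agreeable_prod_society_right)
  moreover have WV: "W \<subseteq> V"
    by (auto simp: W_def)
  ultimately have "agreeable k m (SY\<lparr>voters := W\<rparr>)"
    using V by (intro agreeable_restrict_voters) auto
  moreover have "wf_society (SY\<lparr>voters := W\<rparr>)"
    using assms(7) V WV finite_subset[OF WV finV] by (auto simp: wf_society_def)
  moreover have "\<forall>v\<in>W. approval SY v \<in> FY"
    using assms(13) V WV by blast
  ultimately obtain q where q: "q \<in> Y"
    "\<beta> * real (card W) \<le> real (card {v \<in> W. q \<in> approval SY v})"
    using popular_platform[of k m "SY\<lparr>voters := W\<rparr>" FY \<beta>] assms(8,17) by auto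

  have "\<alpha> * \<beta> * real (card V) = \<beta> * (\<alpha> * real (card V))"
    by simp
  also have "\<dots> \<le> \<beta> * real (card W)"
    using p(2) assms(16) by (intro mult_left_mono) (auto simp: W_def)
  also have "\<dots> \<le> real (card {v \<in> W. q \<in> approval SY v})"
    by (rule q(2))
  also have "{v \<in> W. q \<in> approval SY v} = {v \<in> voters S. (p, q) \<in> approval S v}"
    using V assms(10) by (auto simp: W_def prod_society_def)
  also have "real (card \<dots>) \<le> real (agreement_number S)"
    using p(1) q(1) assms(6,8,10) V finV
    by (intro of_nat_mono card_approvers_le_agreement_number) (auto simp: prod_society_def)
  finally show ?thesis
    using posV V by (simp add: agreement_proportion_def society_size_def pos_le_divide_eq)
qed

end
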